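(* Let $\varepsilon > 0$ be a real number and let $d \geq 2$ be an integer. Let $p = p(n) = \omega(1)/n$, i.e. $p = f(n)/n$ for some function $f$ with $f(n) \to \infty$. For each $n$, let $T$ be a tree on at most $(1-\varepsilon)n$ vertices with maximum degree at most $d$. Let $G \sim \mathbb{G}(n,p)$ and let $\psi$ be an $n$-uniform colouring of $G$. Then asymptotically almost surely $(G,\psi)$ admits a $\psi$-rainbow copy of $T$, i.e. a subgraph of $G$ isomorphic to $T$ all of whose edges receive distinct colours under $\psi$.
   Context: $\mathbb{G}(n,p)$ denotes the binomial random graph on vertex set $[n]$ in which each pair is an edge independently with probability $p$. An edge colouring of a graph $G$ is $k$-uniform if the colour of every edge is chosen independently and uniformly at random from a fixed palette of size $k$ (here $[k]$). A subgraph $H$ of an edge-coloured graph is $\psi$-rainbow if all its edges have pairwise distinct colours. "Asymptotically almost surely" (a.a.s.) means with probability tending to $1$ as $n \to \infty$. *)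

theory Defs
  imports "HOL-Probability.Probability" "HOL-Library.Ramsey"
begin

type_synonym 'a ugraph = "'a set \<times> 'a set set"

abbreviation verts :: "'a ugraph \<Rightarrow> 'a set" where "verts \<equiv> fst"
abbreviation edges :: "'a ugraph \<Rightarrow> 'a set set" where "edges \<equiv> snd"

definition simple_graph :: "'a ugraph \<Rightarrow> bool" where
  "simple_graph G \<longleftrightarrow> finite (verts G) \<and> edges G \<subseteq> nsets (verts G) 2"

definition degree :: "'a ugraph \<Rightarrow> 'a \<Rightarrow> nat" where
  "degree G v = card {e \<in> edges G. v \<in> e}"

(* meaningful only for finite graphs with at least one vertex; trees are nonempty below *)
definition max_degree :: "'a ugraph \<Rightarrow> nat" where
  "max_degree G = Max (degree G ` verts G)"

definition connected_graph :: "'a ugraph \<Rightarrow> bool" where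
  "connected_graph G \<longleftrightarrow> verts G \<noteq> {} \<and>
     (\<forall>u\<in>verts G. \<forall>v\<in>verts G. (u, v) \<in> {(x, y). {x, y} \<in> edges G}\<^sup>*)"

definition is_cycle :: "'a ugraph \<Rightarrow> 'a list \<Rightarrow> bool" where
  "is_cycle G xs \<longleftrightarrow> 3 \<le> length xs \<and> distinct xs \<and>
     (\<forall>i<length xs. {xs ! i, xs ! (Suc i mod length xs)} \<in> edges G)"

definition is_tree :: "'a ugraph \<Rightarrow> bool" where
  "is_tree G \<longleftrightarrow> simple_graph G \<and> connected_graph G \<and> (\<nexists>xs. is_cycle G xs)"

definition subgraph :: "'a ugraph \<Rightarrow> 'a ugraph \<Rightarrow> bool" where
  "subgraph H G \<longleftrightarrow> simple_graph H \<and> verts H \<subseteq> verts G \<and> edges H \<subseteq> edges G"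

definition graph_isomorphic :: "'a ugraph \<Rightarrow> 'b ugraph \<Rightarrow> bool" where
  "graph_isomorphic G H \<longleftrightarrow> (\<exists>f. bij_betw f (verts G) (verts H) \<and>
     (\<forall>u\<in>verts G. \<forall>v\<in>verts G. {u, v} \<in> edges G \<longleftrightarrow> {f u, f v} \<in> edges H))"

definition rainbow :: "('a set \<Rightarrow> nat) \<Rightarrow> 'a ugraph \<Rightarrow> bool" where
  "rainbow \<psi> H \<longleftrightarrow> inj_on \<psi> (edges H)"

definition admits_rainbow_copy :: "'a ugraph \<Rightarrow> ('a set \<Rightarrow> nat) \<Rightarrow> 'b ugraph \<Rightarrow> bool" where
  "admits_rainbow_copy G \<psi> T \<longleftrightarrow>
     (\<exists>H. subgraph H G \<and> graph_isomorphic H T \<and> rainbow \<psi> H)"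

definition binomial_random_graph :: "nat \<Rightarrow> real \<Rightarrow> nat ugraph pmf" where
  "binomial_random_graph n p =
     map_pmf (\<lambda>b. ({1..n}, {e \<in> nsets {1..n} 2. b e}))
       (Pi_pmf (nsets {1..n} 2) False (\<lambda>_. bernoulli_pmf p))"

(* the palette is {1..k}; intended for k > 0 and finitely many edges;
   the value 0 on non-edges is a dummy and is not a colour *)
definition uniform_colouring :: "nat \<Rightarrow> 'a ugraph \<Rightarrow> ('a set \<Rightarrow> nat) pmf" where
  "uniform_colouring k G = Pi_pmf (edges G) 0 (\<lambda>_. pmf_of_set {1..k})"

definition coloured_random_graph :: "nat \<Rightarrow> real \<Rightarrow> nat \<Rightarrow> (nat ugraph \<times> (nat set \<Rightarrow> nat)) pmf" where
  "coloured_random_graph n p k =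
     bind_pmf (binomial_random_graph n p)
       (\<lambda>G. map_pmf (\<lambda>\<psi>. (G, \<psi>)) (uniform_colouring k G))"

end

theory Submission
  imports Defs
begin

text \<open>
  Reduction to uncoloured graphs (McDiarmid's coupling): replace, one pair of vertices at a time,
  a coloured edge present with probability \<open>p\<close> by a wild edge present with probability
  \<open>\<epsilon> p\<close> that fits every rainbow copy. If a copy of the tree depends on this pair, then its
  other edges block at most \<open>(1 - \<epsilon>) n\<close> colours, so the coloured edge completes the copy with
  probability at least \<open>\<epsilon> p\<close>. Hence the rainbow problem at \<open>p\<close> is at least as likely to
  succeed as the uncoloured problem at \<open>\<epsilon> p\<close>.

  In the uncoloured random graph a union bound shows that any two disjoint sets of size
  \<open>m = \<Theta>(n)\<close> are joined by an edge. Such a graph contains every bounded-degree tree on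
  \<open>(1 - \<epsilon>) n\<close> vertices: after deleting fewer than \<open>m\<close> vertices all small sets expand, and the
  tree is embedded vertex by vertex while preserving an expansion invariant in the manner of
  Friedman--Pippenger and Haxell.
\<close>

section \<open>Joined graphs, extendability and cleaning\<close>

text \<open>A graph is given by its neighbourhood function \<open>N\<close>. For symmetric
  \<open>N\<close> this is the property that any two disjoint sets of at least \<open>m\<close>
  vertices have an edge between them, phrased through the vertices that \<open>U\<close> misses
  because the counting arguments need a bound on exactly those.\<close>

definition joined :: "('v \<Rightarrow> 'v set) \<Rightarrow> 'v set \<Rightarrow> nat \<Rightarrow> bool" where
  "joined N V m \<longleftrightarrow> (\<forall>U\<subseteq>V. m \<le> card U \<longrightarrow> card (V - U - \<Union>(N ` U)) < m)"

text \<open>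
  The function \<open>c\<close> counts the children that each vertex still has to receive, \<open>W\<close> is the set of
  vertices already used by the partial embedding.
\<close>
definition extendable :: "('v \<Rightarrow> 'v set) \<Rightarrow> 'v set \<Rightarrow> nat \<Rightarrow> 'v set \<Rightarrow> ('v \<Rightarrow> nat) \<Rightarrow> bool" where
  "extendable N V m W c \<longleftrightarrow> (\<forall>U\<subseteq>V. card U \<le> 2 * m \<longrightarrow> sum c U \<le> card (\<Union>(N ` U) - W))"

text \<open>
  If every choice of the new vertex fails, then every neighbour \<open>y\<close> of \<open>s\<close> outside \<open>W\<close> is
  adjacent to a set that avoids \<open>s\<close> and satisfies the extendability inequality with equality.
  Tight sets have fewer than \<open>m\<close> elements and are closed under union by submodularity; adding
  \<open>s\<close> to the union of all of them violates extendability.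
\<close>
lemma extendable_step:
  fixes N :: "'v \<Rightarrow> 'v set"
  assumes fin: "finite V" and N: "\<And>u. u \<in> V \<Longrightarrow> N u \<subseteq> V"
    and joined: "joined N V m" and m: "1 \<le> m"
    and room: "card W + 3 * m + 2 * d * m \<le> card V" and W: "W \<subseteq> V"
    and c: "\<And>u. u \<in> V \<Longrightarrow> c u \<le> d"
    and ext: "extendable N V m W c" and s: "s \<in> V" "1 \<le> c s"
  obtains y where "y \<in> N s - W" "extendable N V m (insert y W) (c(s := c s - 1))"
proof (rule ccontr)
  note found = that
  assume "\<not> thesis"
  then have bad: "\<not> extendable N V m (insert y W) (c(s := c s - 1))" if "y \<in> N s - W" for y
    using found that by blast
  define G where "G U = \<Union>(N ` U) - W" for U
  define crit where "crit U \<longleftrightarrow> U \<subseteq> V \<and> card U \<le> 2 * m \<and> card (G U) = sum c U" for U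
  have finU: "finite U" if "U \<subseteq> V" for U
    using fin finite_subset that by blast
  have finG: "finite (G U)" if "U \<subseteq> V" for U
  proof -
    have "G U \<subseteq> V" unfolding G_def using N that by blast
    then show ?thesis using fin finite_subset by blast
  qed
  have ext': "sum c U \<le> card (G U)" if "U \<subseteq> V" "card U \<le> 2 * m" for U
    using ext that unfolding extendable_def G_def by blast
  \<comment> \<open>For a tight \<open>U\<close> of size at least \<open>m\<close>, the set
    \<open>V\<close> is covered by \<open>U\<close>, fewer than \<open>m\<close> missed vertices,
    \<open>G U\<close> and \<open>W\<close>. Tightness bounds \<open>G U\<close> by
    \<open>2 * d * m\<close>, so \<open>V\<close> would be smaller than \<open>room\<close>
    demands.\<close>
  have small: "card U < m" if "crit U" for U
  proof (rule ccontr)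
    assume "\<not> card U < m"
    have U: "U \<subseteq> V" "card U \<le> 2 * m" "card (G U) = sum c U" using that unfolding crit_def by auto
    have R: "card (V - U - \<Union>(N ` U)) < m"
      using joined \<open>\<not> card U < m\<close> U(1) unfolding joined_def by auto
    have "sum c U \<le> card U * d"
      using sum_bounded_above[of U c d] U(1) c by auto
    also have "\<dots> \<le> 2 * m * d" using U(2) by simp
    finally have S: "card (G U) \<le> 2 * d * m" using U(3) by (simp add: mult.commute mult.left_commute)
    have "card V \<le> card (U \<union> (V - U - \<Union>(N ` U)) \<union> G U \<union> W)"
      by (rule card_mono) (use finU[OF U(1)] finG[OF U(1)] fin finU[OF W] in \<open>auto simp: G_def\<close>)
    also have "\<dots> \<le> card U + card (V - U - \<Union>(N ` U)) + card (G U) + card W"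
      by (meson add_mono card_Un_le le_refl le_trans)
    finally show False using R S U(2) room by linarith
  qed
  \<comment> \<open>Both sets have fewer than \<open>m\<close> elements, so their union stays within
    the size \<open>2 * m\<close> up to which \<open>extendable\<close> speaks. The inequalities for
    union and intersection add up to an equality, so both are tight.\<close>
  have union: "crit (A \<union> B)" if A: "crit A" and B: "crit B" for A B
  proof -
    have sub: "A \<subseteq> V" "B \<subseteq> V" using A B unfolding crit_def by auto
    have size: "card (A \<union> B) \<le> 2 * m"
      using small[OF A] small[OF B] card_Un_le[of A B] by linarith
    have sizeI: "card (A \<inter> B) \<le> 2 * m"
      using small[OF A] card_mono[of A "A \<inter> B"] finU[OF sub(1)] by fastforce
    have 1: "G (A \<union> B) = G A \<union> G B" unfolding G_def by auto
    have 2: "card (G (A \<inter> B)) \<le> card (G A \<inter> G B)"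
      by (rule card_mono) (use finG[OF sub(1)] in \<open>auto simp: G_def\<close>)
    have 3: "card (G A) + card (G B) = card (G A \<union> G B) + card (G A \<inter> G B)"
      by (rule card_Un_Int) (use finG sub in auto)
    have 4: "sum c (A \<union> B) + sum c (A \<inter> B) = sum c A + sum c B"
      by (rule sum.union_inter) (use finU sub in auto)
    have 5: "sum c (A \<union> B) \<le> card (G (A \<union> B))" by (rule ext') (use sub size in auto)
    have 6: "sum c (A \<inter> B) \<le> card (G (A \<inter> B))" by (rule ext') (use sub sizeI in auto)
    have "card (G (A \<union> B)) = sum c (A \<union> B)"
      using 1 2 3 4 5 6 A B unfolding crit_def by simp
    then show ?thesis using sub size unfolding crit_def by auto
  qed
  \<comment> \<open>A set \<open>U\<close> violating the updated inequality cannot contain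
    \<open>s\<close>: there the demand drops by one, which makes up for the loss of
    \<open>y\<close>. Hence its demand is unchanged, and the loss of \<open>y\<close> alone breaks
    an inequality that was therefore tight.\<close>
  have single: "\<exists>U. crit U \<and> s \<notin> U \<and> y \<in> \<Union>(N ` U)" if y: "y \<in> N s - W" for y
  proof -
    obtain U where U: "U \<subseteq> V" "card U \<le> 2 * m"
      "card (\<Union>(N ` U) - insert y W) < sum (c(s := c s - 1)) U"
      using bad[OF y] unfolding extendable_def by (auto simp: not_le)
    have eq: "\<Union>(N ` U) - insert y W = G U - {y}" unfolding G_def by auto
    have le: "sum c U \<le> card (G U)" using ext' U by blast
    have s': "s \<notin> U"
    proof
      assume sU: "s \<in> U"
      have "sum c U = c s + sum c (U - {s})"
        "sum (c(s := c s - 1)) U = c s - 1 + sum (c(s := c s - 1)) (U - {s})"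
        using sum.remove[OF finU[OF U(1)] sU, of c] sum.remove[OF finU[OF U(1)] sU, of "c(s := c s - 1)"]
        by (simp_all del: fun_upd_apply add: fun_upd_same)
      moreover have "sum (c(s := c s - 1)) (U - {s}) = sum c (U - {s})" by (rule sum.cong) auto
      ultimately have "sum (c(s := c s - 1)) U + 1 = sum c U" using s by simp
      moreover have "card (G U) \<le> card (G U - {y}) + 1" by (auto simp: card_Diff_singleton_if)
      ultimately show False using U(3) le unfolding eq by linarith
    qed
    then have "sum (c(s := c s - 1)) U = sum c U" by (intro sum.cong) auto
    then have lt: "card (G U - {y}) < sum c U" using U(3) eq by simp
    then have yG: "y \<in> G U" using le by (metis Diff_insert0 Diff_empty not_le)
    then have "card (G U - {y}) = card (G U) - 1" by simp
    then have "card (G U) = sum c U" using lt le by linarith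
    then show ?thesis using U s' yG unfolding crit_def G_def by blast
  qed
  have cover: "\<exists>U. crit U \<and> s \<notin> U \<and> Y \<subseteq> \<Union>(N ` U)" if "finite Y" "Y \<subseteq> N s - W" for Y
    using that
  proof (induction Y rule: finite_induct)
    case empty
    have "crit {}" unfolding crit_def G_def by simp
    then show ?case by blast
  next
    case (insert y Y)
    then obtain U where U: "crit U" "s \<notin> U" "Y \<subseteq> \<Union>(N ` U)" by auto
    have "y \<in> N s - W" using insert.prems by simp
    from single[OF this] obtain U' where U': "crit U'" "s \<notin> U'" "y \<in> \<Union>(N ` U')" by blast
    have "crit (U \<union> U')" "s \<notin> U \<union> U'" "insert y Y \<subseteq> \<Union>(N ` (U \<union> U'))"
      using union[OF U(1) U'(1)] U(2,3) U'(2,3) by auto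
    then show ?case by blast
  qed
  have "finite (N s - W)" using N[OF s(1)] fin finite_subset by blast
  then obtain U where U: "crit U" "s \<notin> U" "N s - W \<subseteq> \<Union>(N ` U)" using cover[of "N s - W"] by auto
  have UV: "U \<subseteq> V" using U(1) unfolding crit_def by auto
  have "G (insert s U) = G U" using U(3) unfolding G_def by auto
  moreover have "sum c (insert s U) = c s + sum c U" using U(2) finU[OF UV] by simp
  moreover have "card (insert s U) \<le> 2 * m"
    using small[OF U(1)] card_insert_le_m1[of "2*m" U s] m by simp
  ultimately have "c s + sum c U \<le> card (G U)" using ext'[of "insert s U"] UV s by auto
  then show False using U(1) s unfolding crit_def by simp
qed

text \<open>Delete a maximum set of fewer than \<open>m\<close> vertices that does not expand.\<close>
lemma joined_clean:
  fixes N :: "'v \<Rightarrow> 'v set"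
  assumes fin: "finite V" and N: "\<And>u. u \<in> V \<Longrightarrow> N u \<subseteq> V"
    and joined: "joined N V m" and m: "1 \<le> m" and room: "(3 * d + 4) * m \<le> card V"
  obtains V' where "V' \<subseteq> V" "card V < card V' + m" "joined (\<lambda>u. N u \<inter> V') V' m"
    "\<And>w. extendable (\<lambda>u. N u \<inter> V') V' m {w} (\<lambda>_. d)"
proof -
  \<comment> \<open>The size bound in \<open>Q\<close> guarantees that a largest non-expanding set
    \<open>B\<close> exists.\<close>
  define Q where "Q B \<longleftrightarrow> B \<subseteq> V \<and> card B < m \<and> card (\<Union>(N ` B) - B) \<le> d * card B" for B
  have "Q {}" unfolding Q_def using m by simp
  moreover have "\<forall>B. Q B \<longrightarrow> card B < m" unfolding Q_def by auto
  ultimately obtain B where B: "Q B" "\<And>B'. Q B' \<Longrightarrow> card B' \<le> card B"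
    using ex_has_greatest_nat[of Q "{}" card m] by blast
  have BV: "B \<subseteq> V" "card B < m" "card (\<Union>(N ` B) - B) \<le> d * card B" using B unfolding Q_def by auto
  have finU: "finite U" if "U \<subseteq> V" for U using fin finite_subset that by blast
  have finN: "finite (\<Union>(N ` U))" if "U \<subseteq> V" for U
    using fin finite_subset[of "\<Union>(N ` U)" V] N that by blast
  define V' where "V' = V - B"
  have V': "V' \<subseteq> V" unfolding V'_def by auto
  have "card V = card V' + card B"
    unfolding V'_def using BV fin by (metis card_Diff_subset card_mono finU le_add_diff_inverse2)
  then have big: "card V < card V' + m" using BV by simp
  have joined': "joined (\<lambda>u. N u \<inter> V') V' m"
    unfolding joined_def
  proof (intro allI impI)
    fix U assume U: "U \<subseteq> V'" "m \<le> card U"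
    have "card (V' - U - (\<Union>u\<in>U. N u \<inter> V')) \<le> card (V - U - \<Union>(N ` U))"
      by (rule card_mono) (use fin V' in auto)
    also have "\<dots> < m" using joined U V' unfolding joined_def by blast
    finally show "card (V' - U - (\<Union>u\<in>U. N u \<inter> V')) < m" .
  qed
  have ext: "extendable (\<lambda>u. N u \<inter> V') V' m {w} (\<lambda>_. d)" for w
    unfolding extendable_def
  proof (intro allI impI, rule ccontr)
    fix U assume U: "U \<subseteq> V'" "card U \<le> 2 * m"
      and no: "\<not> (\<Sum>_\<in>U. d) \<le> card ((\<Union>u\<in>U. N u \<inter> V') - {w})"
    have UV: "U \<subseteq> V" using U V' by auto
    have "card U \<noteq> 0" using no by (metis mult_is_0 sum_constant le0 of_nat_id)
    have f: "finite (\<Union>u\<in>U. N u \<inter> V')"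
      by (rule finite_subset[OF _ finN[OF UV]]) auto
    \<comment> \<open>The inequality fails strictly, which absorbs the single vertex
      \<open>w\<close>.\<close>
    have "card (\<Union>u\<in>U. N u \<inter> V') \<le> card ((\<Union>u\<in>U. N u \<inter> V') - {w}) + 1" by (auto simp: card_Diff_singleton_if)
    then have X: "card (\<Union>u\<in>U. N u \<inter> V') \<le> d * card U" using no by (simp add: mult.commute)
    have BUV: "B \<union> U \<subseteq> V" using BV UV by auto
    have cBU: "card (B \<union> U) = card B + card U"
      by (rule card_Un_disjoint) (use finU BV UV U in \<open>auto simp: V'_def\<close>)
    have "card (\<Union>(N ` (B \<union> U)) - (B \<union> U)) \<le> card ((\<Union>(N ` B) - B) \<union> (\<Union>u\<in>U. N u \<inter> V'))"
    proof (rule card_mono)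
      show "finite ((\<Union>(N ` B) - B) \<union> (\<Union>u\<in>U. N u \<inter> V'))" using f finN[OF BV(1)] by blast
      show "\<Union>(N ` (B \<union> U)) - (B \<union> U) \<subseteq> (\<Union>(N ` B) - B) \<union> (\<Union>u\<in>U. N u \<inter> V')"
        using N UV unfolding V'_def by fastforce
    qed
    also have "\<dots> \<le> d * card B + d * card U"
      using card_Un_le BV(3) X by (meson add_mono le_trans)
    finally have exp: "card (\<Union>(N ` (B \<union> U)) - (B \<union> U)) \<le> d * card (B \<union> U)"
      by (simp add: cBU distrib_left)
    \<comment> \<open>\<open>B \<union> U\<close> again fails to expand, so by maximality of
      \<open>B\<close> it has at least \<open>m\<close> elements and \<open>joined\<close> applies
      to it.\<close>
    have "\<not> card (B \<union> U) < m"
    proof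
      assume "card (B \<union> U) < m"
      then have "Q (B \<union> U)" unfolding Q_def using exp BUV by auto
      then show False using B(2) cBU \<open>card U \<noteq> 0\<close> by fastforce
    qed
    then have R: "card (V - (B \<union> U) - \<Union>(N ` (B \<union> U))) < m"
      using joined BUV unfolding joined_def not_less by blast
    have "card V \<le> card ((B \<union> U) \<union> (V - (B \<union> U) - \<Union>(N ` (B \<union> U))) \<union> (\<Union>(N ` (B \<union> U)) - (B \<union> U)))"
      by (rule card_mono) (use fin finU[OF BUV] finN[OF BUV] in auto)
    also have "\<dots> \<le> card (B \<union> U) + card (V - (B \<union> U) - \<Union>(N ` (B \<union> U))) + card (\<Union>(N ` (B \<union> U)) - (B \<union> U))"
      by (meson add_mono card_Un_le le_refl le_trans)
    also have "\<dots> < card (B \<union> U) + m + d * card (B \<union> U)" using R exp by linarith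
    \<comment> \<open>Fewer than \<open>m\<close> vertices of \<open>B\<close> and at most
      \<open>2 * m\<close> of \<open>U\<close>; this is the origin of the constant
      \<open>(3 * d + 4) * m\<close>.\<close>
    also have "\<dots> \<le> 3 * m + m + d * (3 * m)"
    proof -
      have "card (B \<union> U) \<le> 3 * m" using cBU BV U by linarith
      then show ?thesis by (intro add_mono mult_left_mono) auto
    qed
    finally show False using room by (simp add: algebra_simps)
  qed
  show thesis using that V' big joined' ext by blast
qed

section \<open>Growing a tree leaf by leaf\<close>

text \<open>Steps are prepended one at a time; if the new vertex already occurs, the path is cut
  back to that occurrence. The resulting path is closed to a cycle in
  \<open>tree_induct\<close>.\<close>

lemma rtrancl_distinct_path:
  assumes "(u, v) \<in> R\<^sup>*"
  obtains xs where "xs \<noteq> []" "hd xs = u" "last xs = v" "distinct xs"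
    "\<And>i. Suc i < length xs \<Longrightarrow> (xs ! i, xs ! Suc i) \<in> R"
proof -
  have "\<exists>xs. xs \<noteq> [] \<and> hd xs = u \<and> last xs = v \<and> distinct xs \<and>
      (\<forall>i. Suc i < length xs \<longrightarrow> (xs ! i, xs ! Suc i) \<in> R)"
    using assms
  proof (induction rule: converse_rtrancl_induct)
    case base
    then show ?case by (intro exI[of _ "[v]"]) auto
  next
    case (step a b)
    then obtain xs where xs: "xs \<noteq> []" "hd xs = b" "last xs = v" "distinct xs"
      "\<And>i. Suc i < length xs \<Longrightarrow> (xs ! i, xs ! Suc i) \<in> R" by blast
    show ?case
    proof (cases "a \<in> set xs")
      case True
      then obtain k where k: "k < length xs" "xs ! k = a" by (metis in_set_conv_nth)
      show ?thesis
        by (intro exI[of _ "drop k xs"]) (use k xs in \<open>auto simp: hd_drop_conv_nth\<close>)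
    next
      case False
      have "((a # xs) ! i, (a # xs) ! Suc i) \<in> R" if "Suc i < length (a # xs)" for i
        using that xs step(1) by (cases i) (auto simp: hd_conv_nth)
      then show ?thesis using xs False by (intro exI[of _ "a # xs"]) auto
    qed
  qed
  then show thesis using that by blast
qed

text \<open>By connectedness some edge leaves every proper nonempty vertex set, so the tree arises
  by attaching one leaf after another. The sets \<open>S\<close> are kept connected internally: a
  second neighbour of \<open>y\<close> in \<open>S\<close> would then close a cycle.\<close>

lemma tree_induct [consumes 1, case_names single add]:
  assumes T: "is_tree T"
    and base: "\<And>x. x \<in> verts T \<Longrightarrow> P {x}"
    and step: "\<And>S s y. S \<subseteq> verts T \<Longrightarrow> s \<in> S \<Longrightarrow> y \<in> verts T - S \<Longrightarrow> {s, y} \<in> edges T \<Longrightarrow>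
      (\<And>t. t \<in> S \<Longrightarrow> {t, y} \<in> edges T \<Longrightarrow> t = s) \<Longrightarrow> P S \<Longrightarrow> P (insert y S)"
  shows "P (verts T)"
proof -
  define R where "R S = {(x, y). x \<in> S \<and> y \<in> S \<and> {x, y} \<in> edges T}" for S
  define conn where "conn S \<longleftrightarrow> (\<forall>u\<in>S. \<forall>v\<in>S. (u, v) \<in> (R S)\<^sup>*)" for S
  have fin: "finite (verts T)" and ne: "verts T \<noteq> {}" and nocyc: "\<And>xs. \<not> is_cycle T xs"
    and con: "\<And>u v. u \<in> verts T \<Longrightarrow> v \<in> verts T \<Longrightarrow> (u, v) \<in> {(x, y). {x, y} \<in> edges T}\<^sup>*"
    and sub: "edges T \<subseteq> nsets (verts T) 2"
    using T unfolding is_tree_def simple_graph_def connected_graph_def by auto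
  have unique: "t = s" if S: "conn S" "s \<in> S" "t \<in> S" "y \<notin> S" "{s, y} \<in> edges T" "{t, y} \<in> edges T" for S s t y
  proof (rule ccontr)
    assume "t \<noteq> s"
    have "(s, t) \<in> (R S)\<^sup>*" using S unfolding conn_def by blast
    then obtain xs where xs: "xs \<noteq> []" "hd xs = s" "last xs = t" "distinct xs"
      "\<And>i. Suc i < length xs \<Longrightarrow> (xs ! i, xs ! Suc i) \<in> R S"
      by (rule rtrancl_distinct_path) blast
    have mem: "xs ! i \<in> S" if "i < length xs" for i
    proof (cases i)
      case 0
      then show ?thesis using xs S by (simp add: hd_conv_nth)
    next
      case (Suc j)
      then show ?thesis using xs(5)[of j] that unfolding R_def by auto
    qed
    then have "y \<notin> set xs" using S(4) by (metis in_set_conv_nth)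
    have len: "2 \<le> length xs"
    proof (rule ccontr)
      assume "\<not> 2 \<le> length xs"
      then obtain a where "xs = [a]" using xs(1) by (cases xs; cases "tl xs") auto
      then show False using xs \<open>t \<noteq> s\<close> by auto
    qed
    have "is_cycle T (xs @ [y])"
      unfolding is_cycle_def
    proof (intro conjI allI impI)
      show "3 \<le> length (xs @ [y])" using len by simp
      show "distinct (xs @ [y])" using xs(4) \<open>y \<notin> set xs\<close> by simp
      fix i assume i: "i < length (xs @ [y])"
      \<comment> \<open>An edge of the path, the edge from its end \<open>t\<close> to
        \<open>y\<close>, and the edge from \<open>y\<close> that wraps around to its start
        \<open>s\<close>.\<close>
      consider "Suc i < length xs" | "Suc i = length xs" | "i = length xs" using i by fastforce
      then show "{(xs @ [y]) ! i, (xs @ [y]) ! (Suc i mod length (xs @ [y]))} \<in> edges T"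
      proof cases
        case 1
        then show ?thesis using xs(5)[OF 1] unfolding R_def by (auto simp: nth_append)
      next
        case 2
        then have "xs ! i = t" using xs by (metis diff_Suc_1 last_conv_nth)
        then show ?thesis using 2 S(6) by (simp add: nth_append)
      next
        case 3
        then show ?thesis using S(5) xs(1,2) by (simp add: nth_append hd_conv_nth insert_commute)
      qed
    qed
    then show False using nocyc by blast
  qed
  have "\<exists>S. S \<subseteq> verts T \<and> card S = Suc k \<and> conn S \<and> P S" if "Suc k \<le> card (verts T)" for k
    using that
  proof (induction k)
    case 0
    obtain x where x: "x \<in> verts T" using ne by blast
    have "conn {x}" unfolding conn_def by simp
    then show ?case using x base by (intro exI[of _ "{x}"]) auto
  next
    case (Suc k)
    then obtain S where S: "S \<subseteq> verts T" "card S = Suc k" "conn S" "P S" by auto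
    have finS: "finite S" using S fin finite_subset by blast
    have "S \<noteq> verts T" using S Suc.prems by auto
    then obtain v where v: "v \<in> verts T" "v \<notin> S" using S by blast
    obtain u where u: "u \<in> S" using S(2) by fastforce
    \<comment> \<open>Otherwise \<open>S\<close> is closed under adjacency, and a walk from
      \<open>u\<close> never reaches \<open>v\<close>.\<close>
    have "\<exists>s\<in>S. \<exists>y. y \<notin> S \<and> {s, y} \<in> edges T"
    proof (rule ccontr)
      assume no: "\<not> ?thesis"
      have "(u, v) \<in> {(x, y). {x, y} \<in> edges T}\<^sup>*" using con u v S by blast
      then have "v \<in> S"
        by (induction rule: rtrancl_induct) (use no u in auto)
      then show False using v by blast
    qed
    then obtain s y where sy: "s \<in> S" "y \<notin> S" "{s, y} \<in> edges T" by blast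
    then have yT: "y \<in> verts T" using sub by (metis doubleton_in_nsets_2 subsetD)
    have "P (insert y S)"
    proof (rule step)
      show "S \<subseteq> verts T" "s \<in> S" "y \<in> verts T - S" "{s, y} \<in> edges T" "P S" using S sy yT by auto
      show "t = s" if "t \<in> S" "{t, y} \<in> edges T" for t using unique[OF S(3) sy(1) that(1) sy(2) sy(3) that(2)] .
    qed
    moreover have "conn (insert y S)"
    proof -
      have mono: "(R S)\<^sup>* \<subseteq> (R (insert y S))\<^sup>*" by (rule rtrancl_mono) (auto simp: R_def)
      have e: "(s, y) \<in> R (insert y S)" "(y, s) \<in> R (insert y S)"
        using sy by (auto simp: R_def insert_commute)
      have a: "(a, s) \<in> (R (insert y S))\<^sup>*" if "a \<in> insert y S" for a
        using that e(2) mono S(3) sy(1) unfolding conn_def by blast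
      have b: "(s, a) \<in> (R (insert y S))\<^sup>*" if "a \<in> insert y S" for a
        using that e(1) mono S(3) sy(1) unfolding conn_def by blast
      show ?thesis unfolding conn_def using a b by (meson rtrancl_trans)
    qed
    moreover have "card (insert y S) = Suc (Suc k)" using sy S finS by simp
    ultimately show ?case using yT S(1) by (intro exI[of _ "insert y S"]) auto
  qed
  from this[of "card (verts T) - 1"] obtain S where "S \<subseteq> verts T" "card S = card (verts T)" "P S"
    using fin ne by (metis One_nat_def Suc_pred card_gt_0_iff order_refl)
  then show ?thesis using fin card_subset_eq by blast
qed

text \<open>Each attached leaf brings at most one new edge, since \<open>s\<close> is its only
  neighbour in \<open>S\<close>. The bound limits the number of colours that a copy of the tree can
  block.\<close>

lemma tree_card_edges_less:
  assumes "is_tree T"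
  shows "card (edges T) < card (verts T)"
proof -
  have fin: "finite (verts T)" and sub: "edges T \<subseteq> nsets (verts T) 2"
    using assms unfolding is_tree_def simple_graph_def by auto
  have finE: "finite (edges T)" using sub fin finite_imp_finite_nsets finite_subset by blast
  have "card {e \<in> edges T. e \<subseteq> verts T} < card (verts T)"
    using assms
  proof (induction rule: tree_induct)
    case (single x)
    have "{e \<in> edges T. e \<subseteq> {x}} = {}"
    proof -
      have "False" if "e \<in> edges T" "e \<subseteq> {x}" for e
      proof -
        have "card e = 2" using sub that unfolding nsets_def by auto
        moreover have "card e \<le> card {x}" using that by (intro card_mono) auto
        ultimately show False by simp
      qed
      then show ?thesis by blast
    qed
    then show ?case by simp
  next
    case (add S s y)
    have "{e \<in> edges T. e \<subseteq> insert y S} \<subseteq> insert {s, y} {e \<in> edges T. e \<subseteq> S}"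
    proof (rule subsetI, elim CollectE conjE)
      fix e assume e: "e \<in> edges T" "e \<subseteq> insert y S"
      then obtain a b where ab: "e = {a, b}" "a \<noteq> b" using sub by (meson nsets2_E subsetD)
      show "e \<in> insert {s, y} {e \<in> edges T. e \<subseteq> S}"
      proof (cases "y \<in> e")
        case True
        then obtain t where t: "e = {t, y}" "t \<noteq> y" using ab by (metis doubleton_eq_iff insertE singletonD)
        then have "t = s" using e add(5)[of t] by auto
        then show ?thesis using t by simp
      next
        case False
        then show ?thesis using e by auto
      qed
    qed
    then have "card {e \<in> edges T. e \<subseteq> insert y S} \<le> card (insert {s, y} {e \<in> edges T. e \<subseteq> S})"
      using finE by (intro card_mono) auto
    also have "\<dots> \<le> Suc (card {e \<in> edges T. e \<subseteq> S})"
      using finE by (simp add: card_insert_if)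
    also have "\<dots> < Suc (card S)" using add(6) by simp
    also have "\<dots> = card (insert y S)"
      using add(3) finite_subset[OF add(1) fin] by simp
    finally show ?case .
  qed
  moreover have "{e \<in> edges T. e \<subseteq> verts T} = edges T" using sub unfolding nsets_def by auto
  ultimately show ?thesis by simp
qed

section \<open>Embedding bounded-degree trees\<close>

text \<open>Leaves are attached along \<open>tree_induct\<close>, each placed by
  \<open>extendable_step\<close>, which keeps the image extendable.\<close>

lemma extendable_embeds_tree:
  fixes N :: "'v \<Rightarrow> 'v set" and T :: "'a ugraph"
  assumes T: "is_tree T" "max_degree T \<le> d"
    and fin: "finite V" and N: "\<And>u. u \<in> V \<Longrightarrow> N u \<subseteq> V" and sym: "\<And>u v. v \<in> N u \<Longrightarrow> u \<in> N v"
    and joined: "joined N V m" and m: "1 \<le> m"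
    and room: "card (verts T) + 3 * m + 2 * d * m \<le> card V"
    and ext: "\<And>w. extendable N V m {w} (\<lambda>_. d)"
  shows "\<exists>\<phi>. inj_on \<phi> (verts T) \<and> \<phi> ` verts T \<subseteq> V \<and> (\<forall>x y. {x, y} \<in> edges T \<longrightarrow> \<phi> y \<in> N (\<phi> x))"
proof -
  have finT: "finite (verts T)" and sub: "edges T \<subseteq> nsets (verts T) 2"
    using T unfolding is_tree_def simple_graph_def by auto
  have finE: "finite (edges T)" using sub finT finite_imp_finite_nsets finite_subset by blast
  have irrefl: "{x, x} \<notin> edges T" for x using sub by (metis doubleton_in_nsets_2 subsetD)
  \<comment> \<open>\<open>D S x\<close> is the number of neighbours of \<open>x\<close> that remain
    to be placed.\<close>
  define D where "D S x = card {y \<in> verts T - S. {x, y} \<in> edges T}" for S x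
  have D: "D S x \<le> d" if "x \<in> verts T" for S x
  proof -
    have "D S x = card ((\<lambda>y. {x, y}) ` {y \<in> verts T - S. {x, y} \<in> edges T})"
      unfolding D_def by (rule card_image[symmetric]) (auto simp: inj_on_def doubleton_eq_iff)
    also have "\<dots> \<le> degree T x" unfolding degree_def by (rule card_mono) (use finE in auto)
    also have "\<dots> \<le> max_degree T" unfolding max_degree_def by (rule Max_ge) (use that finT in auto)
    finally show ?thesis using T by simp
  qed
  define good where "good S \<phi> c \<longleftrightarrow> inj_on \<phi> S \<and> \<phi> ` S \<subseteq> V \<and>
      (\<forall>x\<in>S. \<forall>y\<in>S. {x, y} \<in> edges T \<longrightarrow> \<phi> y \<in> N (\<phi> x)) \<and>
      (\<forall>u. c u \<le> d) \<and> (\<forall>u. u \<notin> \<phi> ` S \<longrightarrow> c u = d) \<and> (\<forall>x\<in>S. D S x \<le> c (\<phi> x)) \<and> extendable N V m (\<phi> ` S) c" for S \<phi> c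
  have "\<exists>\<phi> c. good (verts T) \<phi> c"
    using T(1)
  proof (induction rule: tree_induct)
    case (single x)
    have "0 < card V" using room m by linarith
    then obtain w where w: "w \<in> V" by fastforce
    have "good {x} (\<lambda>_. w) (\<lambda>_. d)" unfolding good_def using w irrefl D[OF single] ext by auto
    then show ?case by blast
  next
    case (add S s y)
    then obtain \<phi> c where g: "good S \<phi> c" by blast
    have inj: "inj_on \<phi> S" and img: "\<phi> ` S \<subseteq> V"
      and hom: "\<And>x y. x \<in> S \<Longrightarrow> y \<in> S \<Longrightarrow> {x, y} \<in> edges T \<Longrightarrow> \<phi> y \<in> N (\<phi> x)"
      and c: "\<And>u. c u \<le> d" and cd: "\<And>u. u \<notin> \<phi> ` S \<Longrightarrow> c u = d" and Dc: "\<And>x. x \<in> S \<Longrightarrow> D S x \<le> c (\<phi> x)"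
      and e: "extendable N V m (\<phi> ` S) c"
      using g unfolding good_def by auto
    have finS: "finite S" using add(1) finT finite_subset by blast
    have Dfin: "finite {z \<in> verts T - S. {x, z} \<in> edges T}" for x using finT by simp
    \<comment> \<open>The vertex \<open>y\<close> itself is still to be placed next to
      \<open>s\<close>.\<close>
    have "0 < D S s" unfolding D_def card_gt_0_iff using add(3,4) Dfin by blast
    then have cs: "1 \<le> c (\<phi> s)" using Dc[OF add(2)] by simp
    have "card (\<phi> ` S) \<le> card (verts T)"
      using card_image_le[OF finS] card_mono[OF finT add(1)] le_trans by blast
    then have room': "card (\<phi> ` S) + 3 * m + 2 * d * m \<le> card V" using room by linarith
    obtain z where z: "z \<in> N (\<phi> s) - \<phi> ` S"
      "extendable N V m (insert z (\<phi> ` S)) (c(\<phi> s := c (\<phi> s) - 1))"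
      by (rule extendable_step[where N = N and V = V and m = m and W = "\<phi> ` S" and d = d and c = c and s = "\<phi> s"])
        (use fin N joined m room' img c e add(2) cs in auto)
    define \<phi>' where "\<phi>' = \<phi>(y := z)"
    have zV: "z \<in> V" using z N add(2) img by blast
    have yS: "y \<notin> S" using add by simp
    have \<phi>'S: "\<phi>' x = \<phi> x" if "x \<in> S" for x using that yS unfolding \<phi>'_def by auto
    have img': "\<phi>' ` insert y S = insert z (\<phi> ` S)"
      using yS unfolding \<phi>'_def by (auto simp: image_iff)
    have "good (insert y S) \<phi>' (c(\<phi> s := c (\<phi> s) - 1))"
      unfolding good_def
    proof (intro conjI)
      show "inj_on \<phi>' (insert y S)"
        using inj z(1) yS \<phi>'S unfolding inj_on_def \<phi>'_def by auto
      show "\<phi>' ` insert y S \<subseteq> V" using img img' zV by auto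
      show "\<forall>u. (c(\<phi> s := c (\<phi> s) - 1)) u \<le> d" using c by (auto intro: le_trans[OF diff_le_self])
      show "\<forall>u. u \<notin> \<phi>' ` insert y S \<longrightarrow> (c(\<phi> s := c (\<phi> s) - 1)) u = d"
        using cd add(2) unfolding img' by auto
      show "extendable N V m (\<phi>' ` insert y S) (c(\<phi> s := c (\<phi> s) - 1))" using z(2) img' by simp
      show "\<forall>x\<in>insert y S. \<forall>x'\<in>insert y S. {x, x'} \<in> edges T \<longrightarrow> \<phi>' x' \<in> N (\<phi>' x)"
      proof (intro ballI impI)
        fix a b assume ab: "a \<in> insert y S" "b \<in> insert y S" "{a, b} \<in> edges T"
        have zs: "z \<in> N (\<phi> s)" "\<phi> s \<in> N z" using z sym by auto
        consider "a \<in> S" "b \<in> S" | "a = y" "b \<in> S" | "a \<in> S" "b = y" | "a = y" "b = y" using ab by auto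
        then show "\<phi>' b \<in> N (\<phi>' a)"
        proof cases
          case 1 then show ?thesis using hom ab \<phi>'S by auto
        next
          case 2 then have "b = s" using add(5) ab by (auto simp: insert_commute)
          then show ?thesis using 2 zs \<phi>'S by (simp add: \<phi>'_def)
        next
          case 3 then have "a = s" using add(5) ab by auto
          then show ?thesis using 3 zs \<phi>'S by (simp add: \<phi>'_def)
        next
          case 4 then show ?thesis using ab irrefl by auto
        qed
      qed
      show "\<forall>x\<in>insert y S. D (insert y S) x \<le> (c(\<phi> s := c (\<phi> s) - 1)) (\<phi>' x)"
      proof
        fix x assume x: "x \<in> insert y S"
        have mono: "D (insert y S) x \<le> D S x" unfolding D_def by (rule card_mono[OF Dfin]) auto
        consider "x = y" | "x = s" | "x \<in> S" "x \<noteq> s" using x by blast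
        then show "D (insert y S) x \<le> (c(\<phi> s := c (\<phi> s) - 1)) (\<phi>' x)"
        proof cases
          case 1
          have "z \<noteq> \<phi> s" "c z = d" using z(1) cd add(2) by auto
          then show ?thesis using 1 D[of y] add(3) unfolding \<phi>'_def by simp
        next
          case 2
          \<comment> \<open>Placing \<open>y\<close> removes exactly one pending neighbour of
            \<open>s\<close>, matching the decrement of \<open>c (\<phi> s)\<close>.\<close>
          have "{v \<in> verts T - insert y S. {s, v} \<in> edges T} = {v \<in> verts T - S. {s, v} \<in> edges T} - {y}"
            by auto
          then have "D (insert y S) s = D S s - 1"
            unfolding D_def using add(3,4) by simp
          then show ?thesis using 2 Dc[OF add(2)] \<phi>'S[OF add(2)] by simp
        next
          case 3
          then have "\<phi>' x \<noteq> \<phi> s" using \<phi>'S inj add(2) unfolding inj_on_def by auto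
          then show ?thesis using 3 Dc[of x] mono \<phi>'S[of x] by simp
        qed
      qed
    qed
    then show ?case by blast
  qed
  then obtain \<phi> c where g: "good (verts T) \<phi> c" by blast
  have "\<phi> y \<in> N (\<phi> x)" if "{x, y} \<in> edges T" for x y
  proof -
    have "x \<in> verts T" "y \<in> verts T" using that sub by (metis doubleton_in_nsets_2 subsetD)+
    then show ?thesis using g that unfolding good_def by blast
  qed
  then show ?thesis using g unfolding good_def by blast
qed

text \<open>Cleaning by \<open>joined_clean\<close> supplies the extendability from which the
  embedding can start.\<close>

lemma joined_embeds_tree:
  fixes N :: "'v \<Rightarrow> 'v set" and T :: "'a ugraph"
  assumes T: "is_tree T" "max_degree T \<le> d"
    and fin: "finite V" and N: "\<And>u. u \<in> V \<Longrightarrow> N u \<subseteq> V" and sym: "\<And>u v. v \<in> N u \<Longrightarrow> u \<in> N v"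
    and joined: "joined N V m" and m: "1 \<le> m"
    and room: "card (verts T) + (3 * d + 4) * m \<le> card V"
  shows "\<exists>\<phi>. inj_on \<phi> (verts T) \<and> \<phi> ` verts T \<subseteq> V \<and> (\<forall>x y. {x, y} \<in> edges T \<longrightarrow> \<phi> y \<in> N (\<phi> x))"
proof -
  have "(3 * d + 4) * m \<le> card V" using room by linarith
  then obtain V' where V': "V' \<subseteq> V" "card V < card V' + m" "joined (\<lambda>u. N u \<inter> V') V' m"
    "\<And>w. extendable (\<lambda>u. N u \<inter> V') V' m {w} (\<lambda>_. d)"
    using joined_clean[where N = N and V = V and m = m and d = d] fin N joined m by blast
  \<comment> \<open>The last \<open>m\<close> pays for the deleted vertices.\<close>
  have "3 * m + 2 * d * m + m \<le> (3 * d + 4) * m" by (simp add: algebra_simps)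
  then have "card (verts T) + 3 * m + 2 * d * m \<le> card V'" using room V'(2) by linarith
  moreover have fin': "finite V'" using fin V' finite_subset by blast
  \<comment> \<open>Neighbourhoods of deleted vertices are emptied as well, because intersecting
    with \<open>V'\<close> alone would destroy symmetry.\<close>
  define N' where "N' u = (if u \<in> V' then N u \<inter> V' else {})" for u
  have eq: "\<Union>(N' ` U) = (\<Union>u\<in>U. N u \<inter> V')" if "U \<subseteq> V'" for U
    using that unfolding N'_def by auto
  have "joined N' V' m" using V'(3) unfolding joined_def by (simp add: eq)
  moreover have "extendable N' V' m {w} (\<lambda>_. d)" for w
    using V'(4)[of w] unfolding extendable_def by (simp add: eq)
  moreover have "u \<in> N' v" if "v \<in> N' u" for u v
    using that sym unfolding N'_def by (auto split: if_splits)
  moreover have "N' u \<subseteq> V'" for u unfolding N'_def by auto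
  ultimately have "\<exists>\<phi>. inj_on \<phi> (verts T) \<and> \<phi> ` verts T \<subseteq> V' \<and> (\<forall>x y. {x, y} \<in> edges T \<longrightarrow> \<phi> y \<in> N' (\<phi> x))"
    using extendable_embeds_tree[where N = N' and V = V' and T = T and d = d and m = m] T fin' m by blast
  moreover have "N' u \<subseteq> N u" for u unfolding N'_def by auto
  ultimately show ?thesis using V'(1) by (meson order_trans subsetD)
qed

section \<open>Copies of a tree as edge sets\<close>

text \<open>Only edge sets are recorded, since presence and colours concern nothing else;
  \<open>admits_rainbow_copyI\<close> restores the vertices.\<close>

definition copies :: "'b set \<Rightarrow> 'a ugraph \<Rightarrow> 'b set set set" where
  "copies V T = {(\<lambda>e. \<phi> ` e) ` edges T |\<phi>. inj_on \<phi> (verts T) \<and> \<phi> ` verts T \<subseteq> V}"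

lemma admits_rainbow_copyI:
  assumes T: "simple_graph T" and F: "F \<in> copies (verts G) T" "F \<subseteq> edges G" "inj_on \<psi> F"
  shows "admits_rainbow_copy G \<psi> T"
proof -
  have finT: "finite (verts T)" and sub: "edges T \<subseteq> nsets (verts T) 2"
    using T unfolding simple_graph_def by auto
  obtain \<phi> where \<phi>: "inj_on \<phi> (verts T)" "\<phi> ` verts T \<subseteq> verts G" "F = (\<lambda>e. \<phi> ` e) ` edges T"
    using F unfolding copies_def by blast
  define H where "H = (\<phi> ` verts T, F)"
  have eV: "e \<subseteq> verts T" if "e \<in> edges T" for e using that sub unfolding nsets_def by auto
  have "F \<subseteq> nsets (\<phi> ` verts T) 2"
  proof
    fix e' assume "e' \<in> F"
    then obtain e where e: "e \<in> edges T" "e' = \<phi> ` e" using \<phi>(3) by blast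
    have "card e = 2" "finite e" using e(1) sub unfolding nsets_def by auto
    moreover have "inj_on \<phi> e" using \<phi>(1) eV[OF e(1)] inj_on_subset by blast
    ultimately show "e' \<in> nsets (\<phi> ` verts T) 2"
      using e eV[OF e(1)] unfolding nsets_def by (auto simp: card_image)
  qed
  then have "subgraph H G" unfolding subgraph_def simple_graph_def H_def using finT \<phi>(2) F(2) by simp
  moreover have "graph_isomorphic H T"
    unfolding graph_isomorphic_def
  proof (intro exI conjI ballI)
    let ?g = "inv_into (verts T) \<phi>"
    show "bij_betw ?g (verts H) (verts T)"
      unfolding H_def using \<phi>(1) by (simp add: bij_betw_inv_into inj_on_imp_bij_betw)
    fix u v assume "u \<in> verts H" "v \<in> verts H"
    then obtain x y where xy: "x \<in> verts T" "y \<in> verts T" "u = \<phi> x" "v = \<phi> y" unfolding H_def by auto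
    have "{u, v} \<in> edges H \<longleftrightarrow> \<phi> ` {x, y} \<in> (\<lambda>e. \<phi> ` e) ` edges T"
      unfolding H_def using \<phi>(3) xy by simp
    also have "\<dots> \<longleftrightarrow> {x, y} \<in> edges T"
    proof
      assume "\<phi> ` {x, y} \<in> (\<lambda>e. \<phi> ` e) ` edges T"
      then obtain e where e: "e \<in> edges T" "\<phi> ` {x, y} = \<phi> ` e" by blast
      then have "{x, y} = e" using inj_on_image_eq_iff[OF \<phi>(1), of "{x, y}" e] eV[OF e(1)] xy by auto
      then show "{x, y} \<in> edges T" using e by simp
    qed (rule imageI)
    also have "\<dots> \<longleftrightarrow> {?g u, ?g v} \<in> edges T" using xy \<phi>(1) by simp
    finally show "{u, v} \<in> edges H \<longleftrightarrow> {?g u, ?g v} \<in> edges T" .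
  qed
  moreover have "rainbow \<psi> H" unfolding rainbow_def H_def using F by simp
  ultimately show ?thesis unfolding admits_rainbow_copy_def by blast
qed

lemma finite_in_copies:
  assumes "is_tree T" "F \<in> copies V T"
  shows "finite F" "card F < card (verts T)"
proof -
  have fin: "finite (verts T)" and sub: "edges T \<subseteq> nsets (verts T) 2"
    using assms(1) unfolding is_tree_def simple_graph_def by auto
  have finE: "finite (edges T)" by (rule finite_subset[OF sub finite_imp_finite_nsets[OF fin]])
  obtain \<phi> where \<phi>: "F = (\<lambda>e. \<phi> ` e) ` edges T" using assms(2) unfolding copies_def by auto
  show "finite F" using finE \<phi> by simp
  have "card F \<le> card (edges T)" unfolding \<phi> by (rule card_image_le[OF finE])
  then show "card F < card (verts T)" using tree_card_edges_less[OF assms(1)] by simp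
qed

lemma joined_contains_copy:
  fixes T :: "'a ugraph" and E :: "'v set set"
  assumes T: "is_tree T" "max_degree T \<le> d" and fin: "finite V" and E: "E \<subseteq> nsets V 2"
    and joined: "joined (\<lambda>u. {v. {u, v} \<in> E}) V m" and m: "1 \<le> m"
    and room: "card (verts T) + (3 * d + 4) * m \<le> card V"
  shows "\<exists>F\<in>copies V T. F \<subseteq> E"
proof -
  have sub: "edges T \<subseteq> nsets (verts T) 2" using T unfolding is_tree_def simple_graph_def by auto
  let ?N = "\<lambda>u. {v. {u, v} \<in> E}"
  have N: "?N u \<subseteq> V" for u
  proof
    fix v assume "v \<in> ?N u"
    then have "{u, v} \<in> nsets V 2" by (intro subsetD[OF E]) simp
    then show "v \<in> V" by simp
  qed
  have sym: "u \<in> ?N v" if "v \<in> ?N u" for u v using that by (simp add: insert_commute)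
  have "\<exists>\<phi>. inj_on \<phi> (verts T) \<and> \<phi> ` verts T \<subseteq> V \<and>
      (\<forall>x y. {x, y} \<in> edges T \<longrightarrow> \<phi> y \<in> ?N (\<phi> x))"
    by (rule joined_embeds_tree[OF T fin N sym joined m room])
  then obtain \<phi> where \<phi>: "inj_on \<phi> (verts T)" "\<phi> ` verts T \<subseteq> V"
    "\<And>x y. {x, y} \<in> edges T \<Longrightarrow> {\<phi> x, \<phi> y} \<in> E"
    by auto
  have "(\<lambda>e. \<phi> ` e) ` edges T \<subseteq> E"
  proof
    fix e' assume "e' \<in> (\<lambda>e. \<phi> ` e) ` edges T"
    then obtain e where e: "e \<in> edges T" "e' = \<phi> ` e" by blast
    have "e \<in> nsets (verts T) 2" using e(1) sub by blast
    then obtain x y where "e = {x, y}" by (rule nsets2_E)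
    then show "e' \<in> E" using \<phi>(3)[of x y] e by simp
  qed
  then show ?thesis using \<phi>(1,2) unfolding copies_def by blast
qed

section \<open>Replacing coloured edges by wild edges\<close>

lemma prob_bind_pmf:
  "measure_pmf.prob (bind_pmf M K) A = measure_pmf.expectation M (\<lambda>x. measure_pmf.prob (K x) A)"
  unfolding measure_pmf_bind
  by (subst measure_pmf.measure_bind[where N = "count_space UNIV"])
    (auto simp: measure_subprob)

text \<open>The coordinates are exchanged one at a time. The hypothesis compares the two laws of one
  coordinate with all others frozen, and averaging over the others preserves the inequality.\<close>

lemma prob_Pi_pmf_mono:
  assumes "finite E"
    and "\<And>e f. e \<in> E \<Longrightarrow> measure_pmf.prob (p e) {x. Q (f(e := x))} \<le> measure_pmf.prob (p' e) {x. Q (f(e := x))}"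
  shows "measure_pmf.prob (Pi_pmf E dflt p) {f. Q f} \<le> measure_pmf.prob (Pi_pmf E dflt p') {f. Q f}"
  using assms
proof (induction E arbitrary: Q rule: finite_induct)
  case empty
  then show ?case by simp
next
  case (insert e E)
  let ?P = "measure_pmf.prob" and ?E = "measure_pmf.expectation"
  have split1: "?P (Pi_pmf (insert e E) dflt p) {f. Q f} =
      ?E (p e) (\<lambda>x. ?P (Pi_pmf E dflt p) {f. Q (f(e := x))})"
    using insert.hyps by (simp add: Pi_pmf_insert' prob_bind_pmf map_pmf_def[symmetric] vimage_def)
  have split2: "?P (bind_pmf M (\<lambda>x. map_pmf (\<lambda>f. f(e := x)) (Pi_pmf E dflt p'))) {f. Q f} =
      ?E M (\<lambda>x. ?P (Pi_pmf E dflt p') {f. Q (f(e := x))})" for M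
    by (simp add: prob_bind_pmf vimage_def)
  \<comment> \<open>The same experiment with coordinate \<open>e\<close> drawn last, so that the
    hypothesis for \<open>e\<close> applies under the expectation.\<close>
  have split3: "?P (bind_pmf M (\<lambda>x. map_pmf (\<lambda>f. f(e := x)) (Pi_pmf E dflt p'))) {f. Q f} =
      ?E (Pi_pmf E dflt p') (\<lambda>f. ?P M {x. Q (f(e := x))})" for M
  proof -
    have "bind_pmf M (\<lambda>x. map_pmf (\<lambda>f. f(e := x)) (Pi_pmf E dflt p')) =
        bind_pmf (Pi_pmf E dflt p') (\<lambda>f. map_pmf (\<lambda>x. f(e := x)) M)"
      unfolding map_pmf_def by (rule bind_commute_pmf)
    then show ?thesis by (simp add: prob_bind_pmf vimage_def)
  qed
  have int: "integrable (measure_pmf M) (\<lambda>x. ?P (K x) (A x))" for M :: "'z pmf" and K :: "'z \<Rightarrow> 'w pmf" and A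
    by (rule measure_pmf.integrable_const_bound[where B = 1]) auto
  have "?E (p e) (\<lambda>x. ?P (Pi_pmf E dflt p) {f. Q (f(e := x))}) \<le>
      ?E (p e) (\<lambda>x. ?P (Pi_pmf E dflt p') {f. Q (f(e := x))})"
  proof (intro integral_mono int)
    fix x
    show "?P (Pi_pmf E dflt p) {f. Q (f(e := x))} \<le> ?P (Pi_pmf E dflt p') {f. Q (f(e := x))}"
    proof (rule insert.IH)
      fix e' f assume e': "e' \<in> E"
      then have "f(e' := y, e := x) = (f(e := x))(e' := y)" for y using insert.hyps by (auto simp: fun_upd_twist)
      then show "?P (p e') {y. Q (f(e' := y, e := x))} \<le> ?P (p' e') {y. Q (f(e' := y, e := x))}"
        using insert.prems[of e' "f(e := x)"] e' by (simp del: fun_upd_apply)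
    qed
  qed
  also have "\<dots> = ?E (Pi_pmf E dflt p') (\<lambda>f. ?P (p e) {x. Q (f(e := x))})"
    using split2[of "p e"] split3[of "p e"] by simp
  also have "\<dots> \<le> ?E (Pi_pmf E dflt p') (\<lambda>f. ?P (p' e) {x. Q (f(e := x))})"
    by (intro integral_mono int) (rule insert.prems, simp)
  also have "\<dots> = ?P (Pi_pmf (insert e E) dflt p') {f. Q f}"
    using split3[of "p' e"] insert.hyps by (simp add: Pi_pmf_insert' map_pmf_def[symmetric])
  finally show ?case using split1 by simp
qed

text \<open>
  The states of a pair of vertices: \<open>0\<close> for a non-edge, \<open>1, \<dots>, n\<close> for an edge of that colour,
  and \<open>Suc n\<close> for a wild edge, which never conflicts with any other edge.
\<close>
definition colour_pmf :: "nat \<Rightarrow> real \<Rightarrow> nat pmf" where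
  "colour_pmf n p = bind_pmf (bernoulli_pmf p) (\<lambda>b. if b then pmf_of_set {1..n} else return_pmf 0)"

definition wild_pmf :: "nat \<Rightarrow> real \<Rightarrow> nat pmf" where
  "wild_pmf n q = map_pmf (\<lambda>b. if b then Suc n else 0) (bernoulli_pmf q)"

text \<open>Drawing the graph first and its colours afterwards amounts to drawing an independent
  state for each pair. This product form is what \<open>prob_Pi_pmf_mono\<close> requires.\<close>

lemma coloured_random_graph_conv_Pi_pmf:
  assumes "n > 0"
  shows "coloured_random_graph n p n =
    map_pmf (\<lambda>h. (({1..n}, {e \<in> nsets {1..n} 2. h e \<noteq> 0}), h)) (Pi_pmf (nsets {1..n} 2) 0 (\<lambda>_. colour_pmf n p))"
proof -
  let ?E = "nsets {1..n} 2"
  have finE: "finite ?E" by (simp add: finite_imp_finite_nsets)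
  have "Pi_pmf ?E 0 (\<lambda>_. colour_pmf n p) = bind_pmf (Pi_pmf ?E False (\<lambda>_. bernoulli_pmf p))
      (\<lambda>b. Pi_pmf ?E 0 (\<lambda>e. if b e then pmf_of_set {1..n} else return_pmf 0))"
    unfolding colour_pmf_def by (rule Pi_pmf_bind[OF finE])
  also have "\<dots> = bind_pmf (Pi_pmf ?E False (\<lambda>_. bernoulli_pmf p))
      (\<lambda>b. Pi_pmf {e \<in> ?E. b e} 0 (\<lambda>_. pmf_of_set {1..n}))"
    by (simp only: Pi_pmf_if_set[OF finE])
  finally have 1: "Pi_pmf ?E 0 (\<lambda>_. colour_pmf n p) = \<dots>" .
  have 2: "map_pmf (\<lambda>h. (({1..n}, {e \<in> ?E. h e \<noteq> 0}), h)) (Pi_pmf {e \<in> ?E. b e} 0 (\<lambda>_. pmf_of_set {1..n})) =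
      map_pmf (\<lambda>h. (({1..n}, {e \<in> ?E. b e}), h)) (Pi_pmf {e \<in> ?E. b e} 0 (\<lambda>_. pmf_of_set {1..n}))" for b
  proof (rule map_pmf_cong[OF refl])
    fix h assume h: "h \<in> set_pmf (Pi_pmf {e \<in> ?E. b e} 0 (\<lambda>_. pmf_of_set {1..n}))"
    \<comment> \<open>Colours start at \<open>1\<close> and the palette is nonempty as
      \<open>n > 0\<close>, so the default \<open>0\<close> marks precisely the non-edges.\<close>
    have "h e \<noteq> 0 \<longleftrightarrow> b e" if "e \<in> ?E" for e
      using h that finE assms by (auto simp: set_Pi_pmf PiE_dflt_def)
    then show "(({1..n}, {e \<in> ?E. h e \<noteq> 0}), h) = (({1..n}, {e \<in> ?E. b e}), h)" by auto
  qed
  show ?thesis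
    unfolding 1 coloured_random_graph_def binomial_random_graph_def uniform_colouring_def
    by (simp only: map_bind_pmf bind_map_pmf 2 fst_conv snd_conv)
qed

text \<open>Interpolates between containing a copy, when every edge is wild, and containing a
  rainbow copy, when none is.\<close>

definition wild_rainbow :: "'e set set \<Rightarrow> nat \<Rightarrow> ('e \<Rightarrow> nat) \<Rightarrow> bool" where
  "wild_rainbow \<F> n h \<longleftrightarrow> (\<exists>F\<in>\<F>. (\<forall>e\<in>F. h e \<noteq> 0) \<and> inj_on h {e \<in> F. h e \<noteq> Suc n})"

text \<open>With the other states fixed there are three cases: success even without
  \<open>e\<close>, failure even with \<open>e\<close> wild, and success with \<open>e\<close> wild
  but not without \<open>e\<close>. Only the last one needs the count of free colours.\<close>

lemma prob_wild_le_prob_colour: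
  assumes n: "n > 0" and p: "0 \<le> p" "p \<le> 1" and q: "0 \<le> q" "q \<le> \<epsilon> * p" "q \<le> 1"
    and \<F>: "\<And>F. F \<in> \<F> \<Longrightarrow> finite F \<and> real (card F) \<le> (1 - \<epsilon>) * real n"
  shows "measure_pmf.prob (wild_pmf n q) {x. wild_rainbow \<F> n (f(e := x))} \<le>
    measure_pmf.prob (colour_pmf n p) {x. wild_rainbow \<F> n (f(e := x))}" 
proof -
  let ?P = "\<lambda>M. measure_pmf.prob M" and ?A = "{x. wild_rainbow \<F> n (f(e := x))}"
  have pmf_c: "pmf (colour_pmf n p) c = p / n" if "c \<in> {1..n}" for c
    unfolding colour_pmf_def using that p n by (subst pmf_bind) auto
  show ?thesis
  proof (cases "0 \<in> ?A")
    case True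
    then obtain F where F: "F \<in> \<F>" "\<forall>e'\<in>F. (f(e := 0)) e' \<noteq> 0" "inj_on (f(e := 0)) {e' \<in> F. (f(e := 0)) e' \<noteq> Suc n}"
      unfolding wild_rainbow_def by blast
    \<comment> \<open>The witness avoids \<open>e\<close>, so it survives every state of
      \<open>e\<close> and both probabilities are \<open>1\<close>.\<close>
    then have "e \<notin> F" by force
    then have eq: "(f(e := x)) e' = (f(e := 0)) e'" if "e' \<in> F" for x e' using that by auto
    have "wild_rainbow \<F> n (f(e := x))" for x
      unfolding wild_rainbow_def
    proof (intro bexI[OF _ F(1)] conjI)
      show "\<forall>e'\<in>F. (f(e := x)) e' \<noteq> 0" using F(2) eq by metis
      show "inj_on (f(e := x)) {e' \<in> F. (f(e := x)) e' \<noteq> Suc n}"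
        using F(3) eq unfolding inj_on_def by (smt (verit) mem_Collect_eq)
    qed
    then show ?thesis by simp
  next
    case False
    have wild: "?P (wild_pmf n q) ?A = ?P (bernoulli_pmf q) {b. (if b then Suc n else 0) \<in> ?A}"
      unfolding wild_pmf_def by (simp add: vimage_def)
    show ?thesis
    proof (cases "Suc n \<in> ?A")
      case False
      then have "{b. (if b then Suc n else 0) \<in> ?A} = {}" using \<open>0 \<notin> ?A\<close> by (auto split: if_splits)
      then show ?thesis using wild by simp
    next
      case True
      then obtain F where F: "F \<in> \<F>" "\<forall>e'\<in>F. (f(e := Suc n)) e' \<noteq> 0"
        "inj_on (f(e := Suc n)) {e' \<in> F. (f(e := Suc n)) e' \<noteq> Suc n}"
        unfolding wild_rainbow_def by blast
      have "{b. (if b then Suc n else 0) \<in> ?A} \<subseteq> {True}" using \<open>0 \<notin> ?A\<close> by (auto split: if_splits)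
      then have "?P (wild_pmf n q) ?A \<le> ?P (bernoulli_pmf q) {True}"
        unfolding wild by (intro measure_pmf.finite_measure_mono) auto
      also have "\<dots> = q" using q by (simp add: measure_pmf_single)
      finally have le: "?P (wild_pmf n q) ?A \<le> q" .
      \<comment> \<open>Colours free for \<open>e\<close>. Removing \<open>f e\<close> too does no
        harm, because \<open>f\<close> takes at most \<open>card F\<close> values on
        \<open>F\<close>.\<close>
      define C where "C = {1..n} - f ` F"
      have good: "C \<subseteq> ?A"
      proof
        fix c assume c: "c \<in> C"
        have "wild_rainbow \<F> n (f(e := c))"
          unfolding wild_rainbow_def
        proof (intro bexI[OF _ F(1)] conjI)
          show "\<forall>e'\<in>F. (f(e := c)) e' \<noteq> 0" using F(2) c unfolding C_def by (auto split: if_splits)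
          show "inj_on (f(e := c)) {e' \<in> F. (f(e := c)) e' \<noteq> Suc n}"
          proof (rule inj_onI)
            fix a b assume a: "a \<in> {e' \<in> F. (f(e := c)) e' \<noteq> Suc n}" and b: "b \<in> {e' \<in> F. (f(e := c)) e' \<noteq> Suc n}"
              and ab: "(f(e := c)) a = (f(e := c)) b"
            have cf: "c \<noteq> f x" if "x \<in> F" for x using c that unfolding C_def by auto
            show "a = b"
            proof (cases "a = e \<or> b = e")
              case True
              then show ?thesis using a b ab cf[of a] cf[of b] by (auto split: if_splits)
            next
              case False
              then show ?thesis using a b ab inj_onD[OF F(3), of a b] by auto
            qed
          qed
        qed
        then show "c \<in> ?A" by simp
      qed
      have finF: "finite F" "real (card F) \<le> (1 - \<epsilon>) * real n" using \<F>[OF F(1)] by auto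
      have "n - card (f ` F) \<le> card C"
        unfolding C_def using diff_card_le_card_Diff[of "f ` F" "{1..n}"] finF by simp
      then have "n \<le> card C + card F" using card_image_le[OF finF(1), of f] by linarith
      then have "real n \<le> real (card C) + real (card F)" by linarith
      then have card: "\<epsilon> * real n \<le> real (card C)" using finF(2) by (simp add: algebra_simps)
      \<comment> \<open>There are at least \<open>\<epsilon> * n\<close> free colours, each of
        probability \<open>p / n\<close>.\<close>
      have "q \<le> \<epsilon> * p" by fact
      also have "\<dots> = \<epsilon> * real n * (p / n)" using n by simp
      also have "\<dots> \<le> real (card C) * (p / n)" using card p by (intro mult_right_mono) auto
      also have "\<dots> = (\<Sum>c\<in>C. pmf (colour_pmf n p) c)" using pmf_c unfolding C_def by simp
      also have "\<dots> = ?P (colour_pmf n p) C"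
        by (rule measure_measure_pmf_finite[symmetric]) (simp add: C_def)
      also have "\<dots> \<le> ?P (colour_pmf n p) ?A" by (intro measure_pmf.finite_measure_mono good) auto
      finally show ?thesis using le by simp
    qed
  qed
qed

section \<open>Union bound for the uncoloured random graph\<close>

text \<open>If the property fails, two disjoint sets of at least \<open>m\<close> vertices span no
  edge between them. There are at most \<open>4 ^ card V\<close> pairs of sets, and each pair leaves
  at least \<open>m * m\<close> edges absent.\<close>

lemma prob_not_joined_le:
  fixes V :: "'v set"
  assumes fin: "finite V" and q: "0 \<le> q" "q \<le> 1"
  shows "measure_pmf.prob (Pi_pmf (nsets V 2) False (\<lambda>_. bernoulli_pmf q))
      {b. \<not> joined (\<lambda>u. {v. {u, v} \<in> {e \<in> nsets V 2. b e}}) V m} \<le> 4 ^ card V * (1 - q) ^ (m * m)"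
proof -
  define E where "E = nsets V 2"
  let ?M = "Pi_pmf E False (\<lambda>_. bernoulli_pmf q)"
  have finE: "finite E" unfolding E_def using fin by (rule finite_imp_finite_nsets)
  define I where "I = {(U, U'). U \<subseteq> V \<and> U' \<subseteq> V \<and> U \<inter> U' = {} \<and> m \<le> card U \<and> m \<le> card U'}"
  define K where "K P = (\<lambda>(u, v). {u, v}) ` (fst P \<times> snd P)" for P :: "'v set \<times> 'v set"
  \<comment> \<open>The event that no pair in \<open>K P\<close> is an edge, written as a product
    set so that its probability factorises.\<close>
  define B where "B P = Pi E (\<lambda>e. if e \<in> K P then {False} else UNIV)" for P
  have I_sub: "I \<subseteq> Pow V \<times> Pow V" unfolding I_def by auto
  have finI: "finite I" using I_sub fin finite_subset by blast
  have "card I \<le> card (Pow V \<times> Pow V)" using I_sub fin by (intro card_mono) auto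
  also have "\<dots> = 4 ^ card V" using fin by (simp add: card_cartesian_product card_Pow flip: power_mult_distrib)
  finally have cardI: "card I \<le> 4 ^ card V" .
  have PB: "measure_pmf.prob ?M (B P) \<le> (1 - q) ^ (m * m)" if P: "P \<in> I" for P
  proof -
    obtain U U' where U: "P = (U, U')" "U \<subseteq> V" "U' \<subseteq> V" "U \<inter> U' = {}" "m \<le> card U" "m \<le> card U'"
      using P unfolding I_def by blast
    have KE: "K P \<subseteq> E" unfolding K_def E_def using U by auto
    have "card (K P) = card (U \<times> U')"
      unfolding K_def using U by (subst card_image) (auto simp: inj_on_def doubleton_eq_iff)
    then have cK: "m * m \<le> card (K P)" using U by (simp add: card_cartesian_product mult_le_mono)
    have "measure_pmf.prob ?M (B P) = (\<Prod>e\<in>E. if e \<in> K P then 1 - q else 1)"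
      unfolding B_def using finE q
      by (subst measure_Pi_pmf_Pi) (auto intro!: prod.cong simp: measure_pmf_single)
    also have "\<dots> = (1 - q) ^ card (K P)"
      using finE KE by (simp add: prod.If_cases Int_absorb1)
    also have "\<dots> \<le> (1 - q) ^ (m * m)" using q cK by (intro power_decreasing) auto
    finally show ?thesis .
  qed
  have "measure_pmf.prob ?M {b. \<not> joined (\<lambda>u. {v. {u, v} \<in> {e \<in> E. b e}}) V m} \<le> measure_pmf.prob ?M (\<Union>P\<in>I. B P)"
  proof (rule measure_pmf.finite_measure_mono)
    show "{b. \<not> joined (\<lambda>u. {v. {u, v} \<in> {e \<in> E. b e}}) V m} \<subseteq> (\<Union>P\<in>I. B P)"
    proof
      fix b assume "b \<in> {b. \<not> joined (\<lambda>u. {v. {u, v} \<in> {e \<in> E. b e}}) V m}"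
      then obtain U where U: "U \<subseteq> V" "m \<le> card U" "\<not> card (V - U - (\<Union>u\<in>U. {v. {u, v} \<in> {e \<in> E. b e}})) < m"
        unfolding joined_def by blast
      define U' where "U' = V - U - (\<Union>u\<in>U. {v. {u, v} \<in> {e \<in> E. b e}})"
      have "(U, U') \<in> I" unfolding I_def using U U'_def by auto
      moreover have "b \<in> B (U, U')" unfolding B_def K_def U'_def by auto
      ultimately show "b \<in> (\<Union>P\<in>I. B P)" by blast
    qed
  qed auto
  also have "\<dots> \<le> (\<Sum>P\<in>I. measure_pmf.prob ?M (B P))"
    by (rule measure_pmf.finite_measure_subadditive_finite[OF finI]) auto
  also have "\<dots> \<le> real (card I) * (1 - q) ^ (m * m)"
    using sum_bounded_above[of I, OF PB] by simp
  also have "\<dots> \<le> 4 ^ card V * (1 - q) ^ (m * m)"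
  proof (intro mult_right_mono)
    have "real (card I) \<le> real (4 ^ card V)" using cardI by (simp only: of_nat_le_iff)
    then show "real (card I) \<le> 4 ^ card V" by simp
  qed (use q in simp)
  finally show ?thesis unfolding E_def .
qed

text \<open>Chains the union bound at \<open>\<epsilon> * p\<close>, the tree embedding and the
  comparison of wild with coloured edges.\<close>

lemma prob_rainbow_copy_ge:
  fixes T :: "'a ugraph"
  assumes T: "is_tree T" "max_degree T \<le> d" and n: "n > 0" and \<epsilon>: "0 < \<epsilon>" "\<epsilon> \<le> 1"
    and size: "real (card (verts T)) \<le> (1 - \<epsilon>) * real n"
    and p: "0 \<le> p" "p \<le> 1" and m: "1 \<le> m" and room: "card (verts T) + (3 * d + 4) * m \<le> n"
  shows "1 - 4 ^ n * (1 - \<epsilon> * p) ^ (m * m) \<le>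
    measure_pmf.prob (coloured_random_graph n p n) {(G, \<psi>). admits_rainbow_copy G \<psi> T}"
proof -
  define q where "q = \<epsilon> * p"
  have q: "0 \<le> q" "q \<le> 1" unfolding q_def using \<epsilon> p by (auto simp: mult_le_one)
  let ?P = "\<lambda>M. measure_pmf.prob M"
  define E where "E = nsets {1..n} 2"
  define \<F> where "\<F> = copies {1..n} T"
  have finE: "finite E" unfolding E_def by (simp add: finite_imp_finite_nsets)
  have simpleT: "simple_graph T" using T unfolding is_tree_def by simp
  have \<F>: "finite F \<and> real (card F) \<le> (1 - \<epsilon>) * real n" if "F \<in> \<F>" for F
    using finite_in_copies[OF T(1), of F "{1..n}"] that size unfolding \<F>_def by force
  let ?B = "Pi_pmf E False (\<lambda>_. bernoulli_pmf q)"
  let ?J = "{b. joined (\<lambda>u. {v. {u, v} \<in> {e \<in> E. b e}}) {1..n} m}"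
  have "?P ?B (- ?J) \<le> 4 ^ n * (1 - q) ^ (m * m)"
    using prob_not_joined_le[of "{1..n}" q m] q unfolding E_def by (simp add: Collect_neg_eq)
  moreover have "?P ?B (- ?J) = 1 - ?P ?B ?J"
    using measure_pmf.prob_compl[of ?J ?B] by (simp add: Compl_eq_Diff_UNIV)
  ultimately have "1 - 4 ^ n * (1 - q) ^ (m * m) \<le> ?P ?B ?J" by simp
  also have "\<dots> \<le> ?P ?B {b. wild_rainbow \<F> n ((\<lambda>c. if c then Suc n else 0) \<circ> b)}"
  proof (intro measure_pmf.finite_measure_mono subsetI)
    fix b assume "b \<in> ?J"
    then obtain F where "F \<in> \<F>" "F \<subseteq> {e \<in> E. b e}"
      using joined_contains_copy[OF T, of "{1..n}" "{e \<in> E. b e}" m] m room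
      unfolding \<F>_def E_def by auto
    moreover have "{e \<in> F. \<not> b e} = {}" if "F \<subseteq> {e \<in> E. b e}" for F using that by auto
    ultimately show "b \<in> {b. wild_rainbow \<F> n ((\<lambda>c. if c then Suc n else 0) \<circ> b)}"
      unfolding wild_rainbow_def by (auto intro!: bexI[of _ F] simp: inj_on_def)
  qed auto
  also have "\<dots> = ?P (Pi_pmf E 0 (\<lambda>_. wild_pmf n q)) {h. wild_rainbow \<F> n h}"
    unfolding wild_pmf_def
    by (subst Pi_pmf_map[OF finE, of "\<lambda>c. if c then Suc n else 0" False]) (auto simp: vimage_def)
  also have "\<dots> \<le> ?P (Pi_pmf E 0 (\<lambda>_. colour_pmf n p)) {h. wild_rainbow \<F> n h}"
    by (intro prob_Pi_pmf_mono[OF finE] prob_wild_le_prob_colour[OF n p q(1) _ q(2), of \<epsilon>])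
      (use \<F> in \<open>auto simp: q_def\<close>)
  also have "\<dots> \<le> ?P (Pi_pmf E 0 (\<lambda>_. colour_pmf n p))
      {h. admits_rainbow_copy ({1..n}, {e \<in> E. h e \<noteq> 0}) h T}"
  proof (rule measure_pmf.finite_measure_mono_AE)
    show "AE h in Pi_pmf E 0 (\<lambda>_. colour_pmf n p). h \<in> {h. wild_rainbow \<F> n h} \<longrightarrow>
        h \<in> {h. admits_rainbow_copy ({1..n}, {e \<in> E. h e \<noteq> 0}) h T}"
    proof (simp only: AE_measure_pmf_iff mem_Collect_eq, intro ballI impI)
      fix h assume h: "h \<in> set_pmf (Pi_pmf E 0 (\<lambda>_. colour_pmf n p))" and w: "wild_rainbow \<F> n h"
      have "set_pmf (colour_pmf n p) \<subseteq> {..n}"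
        unfolding colour_pmf_def using n by (auto split: if_splits)
      \<comment> \<open>No wild edges are left after the comparison, so the witness is injectively
        coloured on all of \<open>F\<close>.\<close>
      then have hn: "h e \<noteq> Suc n" for e
        using h finE by (cases "e \<in> E") (auto simp: set_Pi_pmf PiE_dflt_def)
      have hE: "e \<in> E" if "h e \<noteq> 0" for e
        using h finE that by (cases "e \<in> E") (auto simp: set_Pi_pmf PiE_dflt_def)
      obtain F where F: "F \<in> \<F>" "\<forall>e\<in>F. h e \<noteq> 0" "inj_on h F"
        using w hn unfolding wild_rainbow_def by auto
      show "admits_rainbow_copy ({1..n}, {e \<in> E. h e \<noteq> 0}) h T"
        by (rule admits_rainbow_copyI[OF simpleT, of F]) (use F hE in \<open>auto simp: \<F>_def\<close>)
    qed
  qed auto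
  also have "\<dots> = ?P (coloured_random_graph n p n) {(G, \<psi>). admits_rainbow_copy G \<psi> T}"
    by (simp add: coloured_random_graph_conv_Pi_pmf[OF n] E_def vimage_def)
  finally show ?thesis unfolding q_def .
qed

section \<open>Choice of parameters and the limit\<close>

theorem theorem1p1:
  fixes \<epsilon> :: real and d :: nat and f p :: "nat \<Rightarrow> real" and T :: "nat \<Rightarrow> 'a ugraph"
  assumes "\<epsilon> > 0" and "d \<ge> 2"
    and "filterlim f at_top sequentially"
    and "\<forall>n>0. p n = f n / real n"
    and "\<forall>n. 0 \<le> p n \<and> p n \<le> 1"
    and "\<forall>\<^sub>F n in sequentially. is_tree (T n) \<and>
           real (card (verts (T n))) \<le> (1 - \<epsilon>) * real n \<and> max_degree (T n) \<le> d"
  shows "(\<lambda>n. measure_pmf.prob (coloured_random_graph n (p n) n)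
           {(G, \<psi>). admits_rainbow_copy G \<psi> (T n)}) \<longlonglongrightarrow> 1"
proof -
  \<comment> \<open>\<open>k\<close> is the factor of \<open>m\<close> in the room condition. The
    \<open>2\<close> in \<open>\<delta>\<close> leaves a margin for rounding: \<open>m\<close> is
    the floor of \<open>2 * (\<delta> * real n)\<close>, hence at least
    \<open>\<delta> * real n\<close> once this is at least \<open>1\<close>.\<close>
  define k where "k = 3 * d + 4"
  have k: "real k > 0" unfolding k_def by simp
  define \<delta> where "\<delta> = \<epsilon> / (2 * real k)"
  have \<delta>: "\<delta> > 0" unfolding \<delta>_def using assms(1) k by simp
  let ?P = "\<lambda>n. measure_pmf.prob (coloured_random_graph n (p n) n) {(G, \<psi>). admits_rainbow_copy G \<psi> (T n)}"
  have "\<forall>\<^sub>F n in sequentially. f n \<ge> 3 / (\<epsilon> * \<delta>\<^sup>2)"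
    using assms(3) unfolding filterlim_at_top by blast
  moreover have "\<forall>\<^sub>F n in sequentially. real n \<ge> 1 / \<delta>"
    using filterlim_real_sequentially unfolding filterlim_at_top by blast
  ultimately have "\<forall>\<^sub>F n in sequentially. 1 - exp (- real n) \<le> ?P n"
    using assms(6) eventually_gt_at_top[of 0]
  proof eventually_elim
    case (elim n)
    \<comment> \<open>A tree has a vertex, so the size bound rules out
      \<open>\<epsilon> > 1\<close>.\<close>
    have "card (verts (T n)) > 0"
      using elim(3) unfolding is_tree_def simple_graph_def connected_graph_def by (simp add: card_gt_0_iff)
    then have "(1 - \<epsilon>) * real n > 0" using elim(3) by linarith
    then have \<epsilon>1: "\<epsilon> \<le> 1" by (simp add: zero_less_mult_iff)
    define m where "m = nat \<lfloor>\<epsilon> * real n / real k\<rfloor>"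
    have x: "\<epsilon> * real n / real k = 2 * (\<delta> * real n)" unfolding \<delta>_def using k by simp
    have dn: "\<delta> * real n \<ge> 1" using elim(2) \<delta> by (simp add: field_simps)
    have m_le: "real m \<le> \<epsilon> * real n / real k"
      unfolding m_def using assms(1) by (intro of_nat_floor) simp
    have "2 * (\<delta> * real n) < real m + 1" unfolding m_def x using dn by linarith
    then have m_ge: "\<delta> * real n \<le> real m" using dn by linarith
    then have m1: "1 \<le> m" using dn by linarith
    have "real k * real m \<le> \<epsilon> * real n" using m_le k by (simp add: field_simps)
    then have "real (card (verts (T n)) + k * m) \<le> real n"
      using elim(3) by (simp add: algebra_simps)
    then have room: "card (verts (T n)) + (3 * d + 4) * m \<le> n" unfolding k_def by linarith
    have pn: "0 \<le> p n" "p n \<le> 1" using assms(5) by auto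
    have q: "0 \<le> \<epsilon> * p n" "\<epsilon> * p n \<le> 1" using assms(1) \<epsilon>1 pn by (auto simp: mult_le_one)
    have "1 - 4 ^ n * (1 - \<epsilon> * p n) ^ (m * m) \<le> ?P n"
      by (rule prob_rainbow_copy_ge) (use elim assms(1) \<epsilon>1 pn m1 room in auto)
    \<comment> \<open>The threshold \<open>3 / (\<epsilon> * \<delta>\<^sup>2)\<close> for
      \<open>f n\<close> makes \<open>\<epsilon> * p n * m * m\<close> at least
      \<open>3 * n\<close>, while \<open>4 ^ n\<close> costs at most
      \<open>exp (2 * n)\<close>.\<close>
    moreover have "4 ^ n * (1 - \<epsilon> * p n) ^ (m * m) \<le> exp (- real n)"
    proof -
      have "(4::real) ^ n \<le> exp 2 ^ n"
      proof (rule power_mono)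
        have "(2::real) * 2 \<le> exp 1 * exp 1" using exp_ge_add_one_self[of 1] by (intro mult_mono) auto
        then show "(4::real) \<le> exp 2" by (simp flip: exp_add)
      qed simp
      also have "\<dots> = exp (2 * real n)" by (simp add: exp_of_nat_mult[symmetric] mult.commute)
      finally have four: "(4::real) ^ n \<le> exp (2 * real n)" .
      have "(1 - \<epsilon> * p n) ^ (m * m) \<le> exp (- (\<epsilon> * p n)) ^ (m * m)"
        using exp_ge_add_one_self[of "- (\<epsilon> * p n)"] q by (intro power_mono) auto
      also have "\<dots> = exp (- (\<epsilon> * p n * (real m * real m)))"
        by (simp add: exp_of_nat_mult[symmetric] algebra_simps)
      also have "\<dots> \<le> exp (- (3 * real n))"
      proof -
        have "3 * real n \<le> \<epsilon> * \<delta>\<^sup>2 * f n * real n"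
          using elim(1) assms(1) \<delta> by (intro mult_right_mono) (auto simp: field_simps)
        also have "\<dots> = \<epsilon> * p n * ((\<delta> * real n) * (\<delta> * real n))"
          using assms(4) elim(4) by (simp add: power2_eq_square)
        also have "\<dots> \<le> \<epsilon> * p n * (real m * real m)"
          using m_ge dn q by (intro mult_left_mono mult_mono) auto
        finally show ?thesis by simp
      qed
      finally have "(1 - \<epsilon> * p n) ^ (m * m) \<le> exp (- (3 * real n))" .
      then have "4 ^ n * (1 - \<epsilon> * p n) ^ (m * m) \<le> exp (2 * real n) * exp (- (3 * real n))"
        using four q by (intro mult_mono) auto
      also have "\<dots> = exp (- real n)" by (simp flip: exp_add)
      finally show ?thesis .
    qed
    ultimately show ?case by linarith
  qed
  moreover have "(\<lambda>n. 1 - exp (- real n)) \<longlonglongrightarrow> 1"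
  proof -
    have "(\<lambda>n. exp (- real n)) \<longlonglongrightarrow> 0"
      by (intro filterlim_compose[OF exp_at_bot] filterlim_compose[OF filterlim_uminus_at_bot_at_top]
          filterlim_real_sequentially)
    from tendsto_diff[OF tendsto_const[of 1] this] show ?thesis by simp
  qed
  ultimately show ?thesis
    by (intro tendsto_sandwich[of "\<lambda>n. 1 - exp (- real n)" ?P sequentially "\<lambda>_. 1"]) auto
qed

end
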